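(* For any positive integers $d$ and $n$ and any integer $s\ge 3d+2$, $$N_{d,ns-1}(s)=N_{d,n(s-1)-1}(s-1)+(n+1)\,N_{d,n(s-d-1)-1}(s-d-1).$$
   Context: A partition $\lambda=(\lambda_1,\dots,\lambda_k)$ is a finite nonincreasing sequence of positive integers (the empty partition is allowed). In its Young diagram (row $i$ has $\lambda_i$ left-justified cells), the hook length $h(i,j)$ of cell $(i,j)$ is $1$ plus the number of cells to its right in its row plus the number of cells below it in its column. For a positive integer $t$, $\lambda$ is $t$-core if no cell has hook length $t$; it is $(s,s+r)$-core if it is both $s$-core and $(s+r)$-core. $\lambda$ has $d$-distinct parts if $\lambda_i-\lambda_{i+1}\ge d$ for all $1\le i\le k-1$. For positive integers $d,r,s$, $N_{d,r}(s)$ is the number of $(s,s+r)$-core partitions with $d$-distinct parts. *)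

theory Defs
  imports Main
begin

definition is_partition :: "nat list \<Rightarrow> bool" where
  "is_partition l \<longleftrightarrow> sorted_wrt (\<ge>) l \<and> (\<forall>x\<in>set l. 0 < x)"

(* Rows and columns are indexed from 0. *)
definition cells :: "nat list \<Rightarrow> (nat \<times> nat) set" where
  "cells l = {(i, j). i < length l \<and> j < l ! i}"

definition hook_length :: "nat list \<Rightarrow> nat \<Rightarrow> nat \<Rightarrow> nat" where
  "hook_length l i j =
     1 + card {j'. j < j' \<and> (i, j') \<in> cells l} + card {i'. i < i' \<and> (i', j) \<in> cells l}"

definition is_core :: "nat \<Rightarrow> nat list \<Rightarrow> bool" where
  "is_core t l \<longleftrightarrow> (\<forall>(i, j) \<in> cells l. hook_length l i j \<noteq> t)"

definition distinct_parts :: "nat \<Rightarrow> nat list \<Rightarrow> bool" where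
  "distinct_parts d l \<longleftrightarrow> (\<forall>i. Suc i < length l \<longrightarrow> l ! Suc i + d \<le> l ! i)"

definition core_partitions :: "nat \<Rightarrow> nat \<Rightarrow> nat \<Rightarrow> nat list set" where
  "core_partitions d r s =
     {l. is_partition l \<and> is_core s l \<and> is_core (s + r) l \<and> distinct_parts d l}"

(* card is the true count only for finite sets; core_partitions d r s is finite
   whenever s and s + r are coprime. *)
definition N :: "nat \<Rightarrow> nat \<Rightarrow> nat \<Rightarrow> nat" where
  "N d r s = card (core_partitions d r s)"

end

theory Submission
  imports Defs
begin

text \<open>A partition is encoded by its beta-set \<open>X\<close>, the set of first-column hook lengths: it is a
  \<open>t\<close>-core iff \<open>X\<close> is closed under subtracting \<open>t\<close>, and it has \<open>d\<close>-distinct parts iff elements of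
  \<open>X\<close> are more than \<open>d\<close> apart. A beta-set closed under subtracting \<open>s\<close> is given by the numbers
  \<open>f i\<close> of its elements congruent to \<open>i\<close> modulo \<open>s\<close>. In terms of \<open>f\<close> the remaining conditions say
  that \<open>f\<close> takes values at most \<open>n + 1\<close> (at most \<open>n\<close> at \<open>s - 1\<close>) on a set of positions more than
  \<open>d\<close> apart, with one more constraint coupling the first and last \<open>d\<close> positions.

  The recurrence comes from the first position \<open>p > d\<close> that is not blocked by an occupied position
  \<open>\<le> d\<close>. If \<open>p\<close> is empty, deleting it shortens \<open>f\<close> by one; otherwise deleting it together with
  the \<open>d\<close> empty positions behind it shortens \<open>f\<close> by \<open>d + 1\<close> and forgets a value in
  \<open>{1..n + 1}\<close>. The bound \<open>s \<ge> 3 d + 2\<close> guarantees that these positions exist and that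
  the two ends stay disjoint.\<close>

section \<open>Beta-sets of partitions\<close>

fun beta :: "nat list \<Rightarrow> nat set" where
  "beta [] = {}"
| "beta (a # l) = insert (a + length l) (beta l)"

lemma finite_beta [simp]: "finite (beta l)"
  by (induction l) auto

lemma is_partition_Nil [simp]: "is_partition []"
  by (simp add: is_partition_def)

lemma is_partition_Cons [simp]:
  "is_partition (a # l) \<longleftrightarrow> 0 < a \<and> (\<forall>x\<in>set l. x \<le> a) \<and> is_partition l"
  by (auto simp: is_partition_def)

lemma beta_less:
  assumes "\<forall>x\<in>set l. x \<le> a" and "x \<in> beta l"
  shows "x < a + length l"
  using assms by (induction l) auto

lemma zero_notin_beta: "is_partition l \<Longrightarrow> 0 \<notin> beta l"
  by (induction l) auto

lemma card_beta: "is_partition l \<Longrightarrow> card (beta l) = length l"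
proof (induction l)
  case (Cons a l)
  then have "a + length l \<notin> beta l" using beta_less[of l a] by auto
  with Cons show ?case by simp
qed simp

lemma Max_beta: "is_partition (a # l) \<Longrightarrow> Max (beta (a # l)) = a + length l"
  by (rule Max_eqI) (auto dest: beta_less[rotated])

text \<open>The number of parts is the cardinality of the beta-set, and the largest part is then
  read off from its maximum; removing the maximum leaves the beta-set of the remaining
  parts.\<close>

lemma beta_inj: "is_partition l \<Longrightarrow> is_partition m \<Longrightarrow> beta l = beta m \<Longrightarrow> l = m"
proof (induction l arbitrary: m)
  case Nil
  then show ?case by (cases m) auto
next
  case (Cons a l)
  from Cons.prems have len: "length m = Suc (length l)"
    using card_beta[of "a # l"] card_beta[of m] by simp
  then obtain b k where m: "m = b # k" by (cases m) auto
  have top: "a + length l = b + length k"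
    using Cons.prems m Max_beta[of a l] Max_beta[of b k] by simp
  have "a + length l \<notin> beta l" "b + length k \<notin> beta k"
    using Cons.prems m beta_less[of l a] beta_less[of k b] by auto
  moreover have "insert (a + length l) (beta l) = insert (a + length l) (beta k)"
    using Cons.prems(3) m top by simp
  ultimately have "beta l = beta k" using top by (metis insert_ident)
  with Cons m top len show ?case by auto
qed

lemma beta_surj: "finite X \<Longrightarrow> 0 \<notin> X \<Longrightarrow> \<exists>l. is_partition l \<and> beta l = X"
proof (induction X rule: finite_linorder_max_induct)
  case empty
  show ?case by (rule exI[of _ "[]"]) simp
next
  case (insert M X)
  then obtain l where l: "is_partition l" "beta l = X" by auto
  \<comment> \<open>The new maximum \<open>M\<close> becomes a new first row of size
    \<open>M - length l\<close>. It is at least the old first row because \<open>M\<close> exceeds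
    the old maximum; if \<open>l\<close> is empty, it is positive because 0 is excluded.\<close>
  have "\<exists>a>0. a + length l = M \<and> (\<forall>x\<in>set l. x \<le> a)"
  proof (cases l)
    case Nil
    with insert show ?thesis by auto
  next
    case (Cons b k)
    with insert l have "b + length k < M" by auto
    with Cons l show ?thesis
      by (intro exI[of _ "M - length l"]) force
  qed
  then obtain a where "0 < a" "a + length l = M" "\<forall>x\<in>set l. x \<le> a" by auto
  with l show ?case by (intro exI[of _ "a # l"]) auto
qed

lemma bij_betw_beta: "bij_betw beta {l. is_partition l} {X. finite X \<and> 0 \<notin> X}"
proof (rule bij_betwI')
  fix X assume "X \<in> {X. finite X \<and> 0 \<notin> (X :: nat set)}"
  then show "\<exists>l\<in>{l. is_partition l}. X = beta l" using beta_surj[of X] by auto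
qed (use beta_inj zero_notin_beta in auto)

text \<open>The gaps of the beta-set are indexed by the columns, and a hook length is the difference
  of an element and a smaller gap.\<close>

lemma not_in_beta_iff:
  "is_partition l \<Longrightarrow> y \<notin> beta l \<longleftrightarrow> (\<exists>j. y = j + length (filter (\<lambda>x. x \<le> j) l))"
proof (induction l arbitrary: y)
  case (Cons a l)
  have all: "filter (\<lambda>x. x \<le> j) l = l" if "a \<le> j" for j
    using Cons.prems that by (force simp: filter_id_conv)
  have le: "length (filter (\<lambda>x. x \<le> j) l) \<le> length l" for j by simp
  have IH: "y \<notin> beta l \<longleftrightarrow> (\<exists>j. y = j + length (filter (\<lambda>x. x \<le> j) l))"
    using Cons by simp
  show ?case
  proof
    assume y: "y \<notin> beta (a # l)"
    then obtain j where j: "y = j + length (filter (\<lambda>x. x \<le> j) l)" using IH by auto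
    show "\<exists>j. y = j + length (filter (\<lambda>x. x \<le> j) (a # l))"
    proof (cases "j < a")
      case True
      with j show ?thesis by (intro exI[of _ j]) auto
    next
      case False
      \<comment> \<open>The new row \<open>a\<close> is now counted too and raises the count by one,
        so the same gap belongs to column \<open>j - 1\<close>. This column is still at least
        \<open>a\<close> because \<open>j = a\<close> would make \<open>y\<close> the new
        element.\<close>
      with j y all[of j] have "y = j + length l" "j \<noteq> a" by auto
      with False all[of "j - 1"] show ?thesis by (intro exI[of _ "j - 1"]) auto
    qed
  next
    assume "\<exists>j. y = j + length (filter (\<lambda>x. x \<le> j) (a # l))"
    then obtain j where j: "y = j + length (filter (\<lambda>x. x \<le> j) (a # l))" by blast
    show "y \<notin> beta (a # l)"
    proof (cases "j < a")
      case True
      with j IH have "y \<notin> beta l" by auto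
      moreover have "y < a + length l" using True j add_less_le_mono[OF True le[of j]] by auto
      ultimately show ?thesis by auto
    next
      case False
      with j all[of j] have y: "y = Suc j + length l" by auto
      with False all[of "Suc j"] IH have "y \<notin> beta l" by (auto intro!: exI[of _ "Suc j"])
      with y False show ?thesis by auto
    qed
  qed
qed simp

section \<open>Hook lengths and the core condition\<close>

lemma hook_length_Cons_Suc: "hook_length (a # l) (Suc i) j = hook_length l i j"
proof -
  have "{i'. Suc i < i' \<and> (i', j) \<in> cells (a # l)} = Suc ` {i'. i < i' \<and> (i', j) \<in> cells l}"
    by (auto simp: cells_def image_iff gr0_conv_Suc less_Suc_eq_0_disj Suc_less_eq2)
  moreover have "{j'. j < j' \<and> (Suc i, j') \<in> cells (a # l)} = {j'. j < j' \<and> (i, j') \<in> cells l}"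
    by (auto simp: cells_def)
  ultimately show ?thesis by (simp add: hook_length_def card_image)
qed

text \<open>The arm has \<open>a - j - 1\<close> cells and the leg one cell for each part of
  \<open>l\<close> exceeding \<open>j\<close>. Hence the hook length is the largest beta element
  minus the gap of column \<open>j\<close>.\<close>

lemma hook_length_Cons_0:
  assumes "j < a"
  shows "hook_length (a # l) 0 j + j + length (filter (\<lambda>x. x \<le> j) l) = a + length l"
proof -
  have "{i'. 0 < i' \<and> (i', j) \<in> cells (a # l)} = Suc ` {i'. i' < length l \<and> j < l ! i'}"
    by (auto simp: cells_def image_iff gr0_conv_Suc)
  then have "card {i'. 0 < i' \<and> (i', j) \<in> cells (a # l)} = length (filter (\<lambda>x. j < x) l)"
    by (simp add: card_image length_filter_conv_card)
  moreover have "{j'. j < j' \<and> (0, j') \<in> cells (a # l)} = {j<..<a}"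
    by (auto simp: cells_def)
  moreover have "length (filter (\<lambda>x. j < x) l) + length (filter (\<lambda>x. x \<le> j) l) = length l"
    using sum_length_filter_compl[of "\<lambda>x. j < x" l] by (simp add: not_less)
  ultimately show ?thesis using assms by (simp add: hook_length_def)
qed

lemma is_core_Cons:
  "is_core t (a # l) \<longleftrightarrow> (\<forall>j<a. hook_length (a # l) 0 j \<noteq> t) \<and> is_core t l"
proof -
  have "cells (a # l) = (\<lambda>j. (0, j)) ` {..<a} \<union> (\<lambda>(i, j). (Suc i, j)) ` cells l"
    by (auto simp: cells_def image_iff less_Suc_eq_0_disj)
  then show ?thesis
    by (simp add: is_core_def ball_Un split_def hook_length_Cons_Suc Ball_def[of "{..<a}"])
qed

definition closed_sub :: "nat \<Rightarrow> nat set \<Rightarrow> bool" where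
  "closed_sub t X \<longleftrightarrow> (\<forall>x\<in>X. t \<le> x \<longrightarrow> x - t \<in> X)"

text \<open>Induction on rows: a hook of length \<open>t\<close> in the first row exists exactly
  when subtracting \<open>t\<close> from the largest element lands on a gap; the other rows form a
  smaller partition.\<close>

lemma is_core_iff_closed_sub:
  assumes "0 < t"
  shows "is_partition l \<Longrightarrow> is_core t l \<longleftrightarrow> closed_sub t (beta l)"
proof (induction l)
  case Nil
  show ?case by (simp add: is_core_def cells_def closed_sub_def)
next
  case (Cons a l)
  let ?M = "a + length l" and ?c = "\<lambda>j. j + length (filter (\<lambda>x. x \<le> j) l)"
  have all: "filter (\<lambda>x. x \<le> j) l = l" if "a \<le> j" for j
    using Cons.prems that by (force simp: filter_id_conv)
  have small: "x < ?M" if "x \<in> beta l" for x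
    using Cons.prems that beta_less by auto
  have row: "(\<exists>j<a. hook_length (a # l) 0 j = t) \<longleftrightarrow> t \<le> ?M \<and> ?M - t \<notin> beta l"
  proof
    assume "\<exists>j<a. hook_length (a # l) 0 j = t"
    then obtain j where "j < a" "hook_length (a # l) 0 j = t" by blast
    with hook_length_Cons_0[of j a l] have "t + ?c j = ?M" by (simp add: add.assoc)
    then have "t \<le> ?M" "?M - t = ?c j" by linarith+
    then show "t \<le> ?M \<and> ?M - t \<notin> beta l"
      using Cons.prems not_in_beta_iff[of l "?M - t"] by auto
  next
    assume t: "t \<le> ?M \<and> ?M - t \<notin> beta l"
    then obtain j where j: "?M - t = ?c j"
      using Cons.prems not_in_beta_iff[of l "?M - t"] by auto
    \<comment> \<open>A column \<open>j\<close> at or beyond \<open>a\<close> has its gap at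
      \<open>j + length l\<close>, hence not below \<open>?M\<close>, whereas \<open>?M - t\<close>
      is below \<open>?M\<close> as \<open>t\<close> is positive.\<close>
    have "j < a"
    proof (rule ccontr)
      assume "\<not> j < a"
      with all[of j] j assms t show False by auto
    qed
    with j t hook_length_Cons_0[of j a l] show "\<exists>j<a. hook_length (a # l) 0 j = t"
      by (intro exI[of _ j]) linarith
  qed
  have "closed_sub t (beta (a # l)) \<longleftrightarrow> (t \<le> ?M \<longrightarrow> ?M - t \<in> beta l) \<and> closed_sub t (beta l)"
    using assms small by (fastforce simp: closed_sub_def)
  with row Cons show ?case by (auto simp: is_core_Cons)
qed

section \<open>Distinct parts as gaps in the beta-set\<close>

definition gapped :: "nat \<Rightarrow> nat set \<Rightarrow> bool" where
  "gapped d X \<longleftrightarrow> (\<forall>x\<in>X. \<forall>y\<in>X. x < y \<longrightarrow> x + d < y)"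

lemma distinct_parts_Cons_Cons:
  "distinct_parts d (a # b # l) \<longleftrightarrow> b + d \<le> a \<and> distinct_parts d (b # l)"
  by (auto simp: distinct_parts_def nth_Cons split: nat.splits)

text \<open>Neighbouring beta elements differ by one more than the corresponding parts, so a
  difference of at least \<open>d\<close> becomes one of more than \<open>d\<close>. Only the two
  largest elements need comparing when a row is added.\<close>

lemma distinct_parts_iff_gapped:
  "is_partition l \<Longrightarrow> distinct_parts d l \<longleftrightarrow> gapped d (beta l)"
proof (induction l)
  case Nil
  show ?case by (simp add: distinct_parts_def gapped_def)
next
  case (Cons a l)
  show ?case
  proof (cases l)
    case Nil
    then show ?thesis by (simp add: distinct_parts_def gapped_def)
  next
    case (Cons b k)
    let ?M = "a + length l" and ?m = "b + length k"
    have m: "?m \<in> beta l" "\<And>x. x \<in> beta l \<Longrightarrow> x \<le> ?m"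
      using Cons.prems Cons beta_less[of k b] by force+
    have M: "\<And>x. x \<in> beta l \<Longrightarrow> x < ?M"
      using Cons.prems beta_less[of l a] by auto
    have "gapped d (beta (a # l)) \<longleftrightarrow> ?m + d < ?M \<and> gapped d (beta l)"
    proof
      assume "gapped d (beta (a # l))"
      then show "?m + d < ?M \<and> gapped d (beta l)"
        using m(1) M[OF m(1)] unfolding gapped_def by auto
    next
      assume g: "?m + d < ?M \<and> gapped d (beta l)"
      have "x + d < ?M" if "x \<in> beta l" for x using m(2)[OF that] g by linarith
      then show "gapped d (beta (a # l))"
        using g M by (auto simp: gapped_def dest: less_asym)
    qed
    with Cons.IH Cons.prems Cons show ?thesis
      by (auto simp: distinct_parts_Cons_Cons)
  qed
qed

lemma N_eq_card_beta_sets: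
  assumes "0 < s"
  shows "N d r s =
    card {X. finite X \<and> 0 \<notin> X \<and> closed_sub s X \<and> closed_sub (s + r) X \<and> gapped d X}"
proof -
  have "core_partitions d r s =
      {l \<in> {l. is_partition l}. closed_sub s (beta l) \<and> closed_sub (s + r) (beta l) \<and> gapped d (beta l)}"
    using assms
    by (auto simp: core_partitions_def is_core_iff_closed_sub distinct_parts_iff_gapped)
  moreover have "bij_betw beta \<dots>
      {X \<in> {X. finite X \<and> 0 \<notin> X}. closed_sub s X \<and> closed_sub (s + r) X \<and> gapped d X}"
    by (rule bij_betw_Collect[OF bij_betw_beta]) simp
  ultimately show ?thesis
    by (auto simp: N_def dest: bij_betw_same_card)
qed

section \<open>Abacus description of simultaneous cores\<close>

text \<open>The abacus with \<open>s\<close> runners and all beads pushed to the bottom: runner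
  \<open>i\<close> carries beads at levels 0 to \<open>f i - 1\<close>, level \<open>k\<close>
  standing for the number \<open>i + k * s\<close>.\<close>

definition abacus :: "nat \<Rightarrow> (nat \<Rightarrow> nat) \<Rightarrow> nat set" where
  "abacus s f = {x. x div s < f (x mod s)}"

lemma mem_abacus: "i < s \<Longrightarrow> i + k * s \<in> abacus s f \<longleftrightarrow> k < f i"
  by (simp add: abacus_def)

lemma abacus_cases:
  assumes "x \<in> abacus s f" and "0 < s"
  obtains i k where "x = i + k * s" "i < s" "k < f i"
proof
  show "x = x mod s + x div s * s" by simp
qed (use assms in \<open>auto simp: abacus_def\<close>)

text \<open>Each \<open>k\<close> in \<open>K\<close> brings all of \<open>{..k}\<close> along, so
  \<open>k < card K\<close>; the inclusion is an equality because the cardinalities agree.\<close>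

lemma downward_closed_eq_lessThan_card:
  fixes K :: "nat set"
  assumes "finite K" and "\<And>k. Suc k \<in> K \<Longrightarrow> k \<in> K"
  shows "K = {..<card K}"
proof -
  have down: "j \<in> K" if "k \<in> K" "j \<le> k" for j k
    using that(2,1) by (induction k rule: dec_induct) (auto intro: assms(2))
  have "K \<subseteq> {..<card K}"
  proof
    fix k assume "k \<in> K"
    then have "{..k} \<subseteq> K" using down by auto
    from card_mono[OF assms(1) this] show "k \<in> {..<card K}" by simp
  qed
  then show ?thesis by (simp add: card_subset_eq)
qed

lemma finite_abacus:
  assumes "0 < s"
  shows "finite (abacus s f)"
proof -
  have "abacus s f \<subseteq> (\<Union>i<s. (\<lambda>k. i + k * s) ` {..<f i})"
    using assms by (auto elim!: abacus_cases)
  then show ?thesis by (rule finite_subset) simp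
qed

lemma closed_sub_abacus:
  assumes "0 < s"
  shows "closed_sub s (abacus s f)"
  unfolding closed_sub_def
proof (intro ballI impI)
  fix x assume "x \<in> abacus s f" "s \<le> x"
  then show "x - s \<in> abacus s f"
    using assms by (simp add: abacus_def le_div_geq le_mod_geq)
qed

text \<open>Closure under subtracting \<open>s\<close> makes the set of levels on each runner an
  initial segment, so its size determines it. Fixing \<open>f\<close> to be 0 from \<open>s\<close>
  on makes the function unique.\<close>

lemma bij_betw_abacus:
  assumes "0 < s"
  shows "bij_betw (abacus s) {f. \<forall>x\<ge>s. f x = 0} {X. finite X \<and> closed_sub s X}"
proof (rule bij_betwI')
  fix f g :: "nat \<Rightarrow> nat"
  assume f: "f \<in> {f. \<forall>x\<ge>s. f x = 0}" and g: "g \<in> {f. \<forall>x\<ge>s. f x = 0}"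
  show "abacus s f = abacus s g \<longleftrightarrow> f = g"
  proof
    assume eq: "abacus s f = abacus s g"
    show "f = g"
    proof
      fix i
      show "f i = g i"
      proof (cases "i < s")
        case True
        with eq have "k < f i \<longleftrightarrow> k < g i" for k by (metis mem_abacus)
        then show ?thesis by (metis less_irrefl linorder_neqE_nat)
      next
        case False
        with f g show ?thesis by simp
      qed
    qed
  qed simp
next
  fix f show "abacus s f \<in> {X. finite X \<and> closed_sub s X}"
    using assms by (simp add: finite_abacus closed_sub_abacus)
next
  fix X assume "X \<in> {X. finite X \<and> closed_sub s X}"
  then have fin: "finite X" and cl: "closed_sub s X" by auto
  define f where "f i = (if i < s then card {k. i + k * s \<in> X} else 0)" for i
  have runner: "{k. i + k * s \<in> X} = {..<f i}" if "i < s" for i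
  proof -
    let ?K = "{k. i + k * s \<in> X}"
    have "inj (\<lambda>k. i + k * s)" using assms by (auto simp: inj_on_def)
    then have "finite ?K"
      using finite_vimageI[OF fin] by (simp add: vimage_def)
    moreover have "k \<in> ?K" if "Suc k \<in> ?K" for k
    proof -
      have "i + Suc k * s \<in> X" "s \<le> i + Suc k * s" using that by auto
      with cl have "i + Suc k * s - s \<in> X" unfolding closed_sub_def by blast
      then show ?thesis by simp
    qed
    ultimately show ?thesis
      using that downward_closed_eq_lessThan_card[of ?K] by (simp add: f_def)
  qed
  have "x \<in> abacus s f \<longleftrightarrow> x \<in> X" for x
  proof -
    have "x div s \<in> {k. x mod s + k * s \<in> X} \<longleftrightarrow> x div s \<in> {..<f (x mod s)}"
      using runner[of "x mod s"] assms by simp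
    then show ?thesis by (simp add: abacus_def)
  qed
  then have "X = abacus s f" by auto
  moreover have "\<forall>x\<ge>s. f x = 0" by (simp add: f_def)
  ultimately show "\<exists>f\<in>{f. \<forall>x\<ge>s. f x = 0}. X = abacus s f" by blast
qed

text \<open>The first clause compares beads on one level. The second is the wraparound: a bead of
  runner \<open>y\<close> at level 1 against one of runner \<open>x\<close> at level 0.\<close>

definition spaced :: "nat \<Rightarrow> nat \<Rightarrow> (nat \<Rightarrow> nat) \<Rightarrow> bool" where
  "spaced d s f \<longleftrightarrow>
     (\<forall>x y. f x \<noteq> 0 \<longrightarrow> f y \<noteq> 0 \<longrightarrow> x < y \<longrightarrow> x + d < y) \<and>
     (\<forall>x y. f x \<noteq> 0 \<longrightarrow> 2 \<le> f y \<longrightarrow> x + d < s + y)"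

lemma gapped_abacus_iff:
  assumes "d < s" and supp: "\<forall>x\<ge>s. f x = 0"
  shows "gapped d (abacus s f) \<longleftrightarrow> spaced d s f"
proof
  assume g: "gapped d (abacus s f)"
  have less: "x < s" if "f x \<noteq> 0" for x using supp that by (meson not_less)
  have mem: "x + k * s \<in> abacus s f" if "k < f x" for x k
    using that less[of x] mem_abacus[of x s k f] by simp
  show "spaced d s f"
    unfolding spaced_def
  proof (intro conjI allI impI)
    fix x y assume "f x \<noteq> 0" "f y \<noteq> 0" "x < y"
    with mem[of 0 x] mem[of 0 y] g show "x + d < y" by (simp add: gapped_def)
  next
    fix x y assume "f x \<noteq> 0" "2 \<le> f y"
    with mem[of 0 x] mem[of 1 y] have "x \<in> abacus s f" "y + s \<in> abacus s f" by simp_all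
    moreover have "x < y + s" using less[OF \<open>f x \<noteq> 0\<close>] by simp
    ultimately have "x + d < y + s" using g unfolding gapped_def by blast
    then show "x + d < s + y" by simp
  qed
next
  assume sp: "spaced d s f"
  show "gapped d (abacus s f)"
    unfolding gapped_def
  proof (intro ballI impI)
    fix x y assume "x \<in> abacus s f" "y \<in> abacus s f" and xy: "x < y"
    then obtain i k j l where x: "x = i + k * s" "i < s" "k < f i"
      and y: "y = j + l * s" "j < s" "l < f j"
      using assms by (metis abacus_cases gr_zeroI not_less_zero)
    show "x + d < y"
    proof (rule ccontr)
      assume "\<not> x + d < y"
      then have le: "j + l * s \<le> i + k * s + d" using x y by simp
      have "k \<le> l"
      proof (rule ccontr)
        assume "\<not> k \<le> l"
        then have "Suc l * s \<le> k * s" by (intro mult_le_mono1) simp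
        with x y xy show False by simp
      qed
      moreover have "l \<le> Suc k"
      proof (rule ccontr)
        assume "\<not> l \<le> Suc k"
        then have "Suc (Suc k) * s \<le> l * s" by (intro mult_le_mono1) simp
        with x y le assms show False by simp
      qed
      \<comment> \<open>Beads at distance at most \<open>d < s\<close> lie on equal or consecutive
        levels. As runners are filled from below, such a pair also occurs on level 0, or on levels 0
        and 1.\<close>
      ultimately consider "l = k" | "l = Suc k" by linarith
      then show False
      proof cases
        case 1
        with x y xy le have "f i \<noteq> 0" "f j \<noteq> 0" "i < j" "j \<le> i + d" by auto
        with sp show False unfolding spaced_def by (meson not_less)
      next
        case 2
        with x y le have "f i \<noteq> 0" "2 \<le> f j" "s + j \<le> i + d" by auto
        with sp show False unfolding spaced_def by (meson not_less)
      qed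
    qed
  qed
qed

text \<open>Since \<open>(n + 1) s - 1\<close> is \<open>-1\<close> modulo \<open>s\<close>, subtracting it moves a bead to the next runner,
  which is empty because of the gaps; so there must be nothing to subtract from.\<close>

lemma closed_sub_abacus_iff:
  assumes "1 \<le> d" "1 < s" and supp: "\<forall>x\<ge>s. f x = 0" and "f 0 = 0" and sp: "spaced d s f"
  shows "closed_sub ((n + 1) * s - 1) (abacus s f) \<longleftrightarrow> (\<forall>x. f x \<le> n + 1) \<and> f (s - 1) \<le> n"
    (is "closed_sub ?T _ \<longleftrightarrow> _")
proof
  assume cl: "closed_sub ?T (abacus s f)"
  \<comment> \<open>The bead at level \<open>n\<close> of runner \<open>s - 1\<close> is
    \<open>?T\<close> itself, so closure would put 0 into the set, against
    \<open>f 0 = 0\<close>.\<close>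
  have last: "f (s - 1) \<le> n"
  proof (rule ccontr)
    assume "\<not> f (s - 1) \<le> n"
    then have "(s - 1) + n * s \<in> abacus s f" using assms by (subst mem_abacus) auto
    moreover have "(s - 1) + n * s = ?T" using assms by (simp add: algebra_simps)
    ultimately have "?T - ?T \<in> abacus s f" using cl unfolding closed_sub_def by fastforce
    with assms show False by (simp add: abacus_def)
  qed
  have "f x \<le> n + 1" for x
  proof (rule ccontr)
    assume big: "\<not> f x \<le> n + 1"
    then have "x < s" using supp by (metis not_less zero_le)
    moreover have "x \<noteq> s - 1" using last big by auto
    ultimately have x: "x + 1 < s" by simp
    have "x + (n + 1) * s \<in> abacus s f" using x big by (subst mem_abacus) auto
    moreover have "?T \<le> x + (n + 1) * s" by simp
    ultimately have "x + (n + 1) * s - ?T \<in> abacus s f"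
      using cl unfolding closed_sub_def by blast
    moreover have "x + (n + 1) * s - ?T = (x + 1) + 0 * s"
      using assms by (simp add: algebra_simps)
    ultimately have "f (x + 1) \<noteq> 0" using mem_abacus[OF x, of 0 f] by simp
    moreover have "f x \<noteq> 0" using big by simp
    ultimately have "x + d < x + 1" using sp unfolding spaced_def by (meson less_add_one)
    with assms show False by simp
  qed
  with last show "(\<forall>x. f x \<le> n + 1) \<and> f (s - 1) \<le> n" by blast
next
  assume b: "(\<forall>x. f x \<le> n + 1) \<and> f (s - 1) \<le> n"
  \<comment> \<open>Under the bounds all beads lie below \<open>?T\<close>, so closure holds
    vacuously.\<close>
  have "e < ?T" if "e \<in> abacus s f" for e
  proof -
    from that assms obtain i k where e: "e = i + k * s" "i < s" "k < f i"
      by (auto elim: abacus_cases)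
    from e b have "k \<le> n" by (metis Suc_eq_plus1 less_Suc_eq_le less_le_trans)
    show ?thesis
    proof (cases "k = n")
      case True
      with b e have "i \<noteq> s - 1" by auto
      with True e show ?thesis by simp
    next
      case False
      with \<open>k \<le> n\<close> have "Suc k * s \<le> n * s" by (intro mult_le_mono1) simp
      with e assms show ?thesis by simp
    qed
  qed
  then show "closed_sub ?T (abacus s f)" unfolding closed_sub_def by (meson not_less)
qed

text \<open>The bead counts of the cores to be counted: \<open>f\<close> vanishes at 0 because 0 is
  never a first-column hook length.\<close>

definition conf :: "nat \<Rightarrow> nat \<Rightarrow> nat \<Rightarrow> (nat \<Rightarrow> nat) set" where
  "conf d n s = {f. (\<forall>x. f x \<noteq> 0 \<longrightarrow> 0 < x \<and> x < s) \<and> (\<forall>x. f x \<le> n + 1) \<and>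
     f (s - 1) \<le> n \<and> spaced d s f}"

lemma N_eq_card_conf:
  assumes "1 \<le> d" "1 \<le> n" "d < s"
  shows "N d (n * s - 1) s = card (conf d n s)"
proof -
  have T: "s + (n * s - 1) = (n + 1) * s - 1" using assms by simp
  have "bij_betw (abacus s)
      {f \<in> {f. \<forall>x\<ge>s. f x = 0}. f \<in> conf d n s}
      {X \<in> {X. finite X \<and> closed_sub s X}. 0 \<notin> X \<and> closed_sub ((n + 1) * s - 1) X \<and> gapped d X}"
  proof (rule bij_betw_Collect[OF bij_betw_abacus])
    fix f :: "nat \<Rightarrow> nat"
    assume "f \<in> {f. \<forall>x\<ge>s. f x = 0}"
    then have supp: "\<forall>x\<ge>s. f x = 0" by simp
    have "0 \<notin> abacus s f \<longleftrightarrow> f 0 = 0" by (simp add: abacus_def)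
    moreover have "(\<forall>x. f x \<noteq> 0 \<longrightarrow> 0 < x \<and> x < s) \<longleftrightarrow> f 0 = 0"
      using supp by (metis gr0I not_less less_irrefl)
    ultimately show "(0 \<notin> abacus s f \<and> closed_sub ((n + 1) * s - 1) (abacus s f) \<and> gapped d (abacus s f))
        \<longleftrightarrow> f \<in> conf d n s"
      using assms supp closed_sub_abacus_iff[of d s f n] gapped_abacus_iff[of d s f]
      by (auto simp: conf_def)
  qed (use assms in simp)
  moreover have "{f \<in> {f. \<forall>x\<ge>s. f x = 0}. f \<in> conf d n s} = conf d n s"
    by (auto simp: conf_def)
  moreover have "{X \<in> {X. finite X \<and> closed_sub s X}. 0 \<notin> X \<and> closed_sub ((n + 1) * s - 1) X \<and> gapped d X}
      = {X. finite X \<and> 0 \<notin> X \<and> closed_sub s X \<and> closed_sub ((n + 1) * s - 1) X \<and> gapped d X}"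
    by auto
  ultimately have "card (conf d n s) = card {X. finite X \<and> 0 \<notin> X \<and> closed_sub s X \<and>
      closed_sub ((n + 1) * s - 1) X \<and> gapped d X}"
    by (simp only: bij_betw_same_card)
  moreover have "0 < s" using assms by simp
  ultimately show ?thesis
    using N_eq_card_beta_sets[of s d "n * s - 1"] by (simp only: T)
qed

lemma finite_conf: "finite (conf d n s)"
proof (rule finite_subset)
  show "conf d n s \<subseteq> {f. \<forall>x. (x \<in> {..<s} \<longrightarrow> f x \<in> {..n + 1}) \<and> (x \<notin> {..<s} \<longrightarrow> f x = 0)}"
    by (auto simp: conf_def)
qed (rule finite_set_of_finite_funs; simp)

section \<open>The recurrence\<close>

text \<open>Among the positions \<open>1, \<dots>, d\<close> at most one is occupied; \<open>i\<close> is that position, or \<open>0\<close>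
  if there is none. Then \<open>d + i + 1\<close> is the first position that is not blocked by it.\<close>

definition headed :: "nat \<Rightarrow> nat \<Rightarrow> (nat \<Rightarrow> nat) set" where
  "headed d i = {f. (\<forall>x\<le>d. f x \<noteq> 0 \<longrightarrow> x = i) \<and> (0 < i \<longrightarrow> f i \<noteq> 0)}"

section \<open>Inserting and deleting blocks of positions\<close>

definition insert_block :: "nat \<Rightarrow> nat \<Rightarrow> nat \<Rightarrow> (nat \<Rightarrow> nat) \<Rightarrow> nat \<Rightarrow> nat" where
  "insert_block p k v f x =
     (if x < p then f x else if x = p then v else if x < p + k then 0 else f (x - k))"

definition delete_block :: "nat \<Rightarrow> nat \<Rightarrow> (nat \<Rightarrow> nat) \<Rightarrow> nat \<Rightarrow> nat" where
  "delete_block p k f x = (if x < p then f x else f (x + k))"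

lemma insert_block_same [simp]: "insert_block p k v f p = v"
  by (simp add: insert_block_def)

lemma delete_insert_block: "0 < k \<Longrightarrow> delete_block p k (insert_block p k v f) = f"
  by (auto simp: delete_block_def insert_block_def)

lemma insert_delete_block:
  "(\<And>x. p < x \<Longrightarrow> x < p + k \<Longrightarrow> f x = 0) \<Longrightarrow> 0 < k \<Longrightarrow>
    insert_block p k (f p) (delete_block p k f) = f"
  by (auto simp: delete_block_def insert_block_def)

lemma headed_support:
  assumes "f \<in> conf d n s" "f \<in> headed d i" "i \<le> d" "f x \<noteq> 0"
  shows "x = i \<and> 0 < i \<or> d + i + 1 \<le> x"
proof (cases "x \<le> d")
  case True
  with assms show ?thesis by (auto simp: headed_def conf_def)
next
  case x: False
  show ?thesis
  proof (cases "0 < i")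
    case True
    with assms(2) have "f i \<noteq> 0" by (auto simp: headed_def)
    moreover have "i < x" using x assms(3) by simp
    ultimately have "i + d < x"
      using assms(1,4) unfolding conf_def spaced_def by blast
    then show ?thesis by simp
  next
    case False
    with x show ?thesis by simp
  qed
qed

text \<open>Either one empty position is inserted, or a value followed by \<open>d\<close> empty
  positions. The block starts at distance \<open>d + 1\<close> behind the head \<open>i\<close>, and
  all later entries shift along with the modulus, so the wraparound distances to the head
  persist.\<close>

lemma insert_block_conf:
  assumes f: "f \<in> conf d n s" "f \<in> headed d i" and "i \<le> d" "2 * d + 1 \<le> s"
    and kv: "k = 1 \<and> v = 0 \<or> k = d + 1 \<and> v \<le> n + 1" and "1 \<le> d"
  shows "insert_block (d + i + 1) k v f \<in> conf d n (s + k) \<inter> headed d i"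
proof -
  let ?p = "d + i + 1"
  let ?g = "insert_block ?p k v f"
  have supp: "x = i \<and> 0 < i \<and> f i \<noteq> 0 \<or> x = ?p \<and> k = d + 1 \<or> ?p + k \<le> x \<and> x < s + k \<and> f (x - k) \<noteq> 0"
    if gx: "?g x \<noteq> 0" for x
  proof -
    consider "x < ?p" "f x \<noteq> 0" | "x = ?p" "v \<noteq> 0" | "?p + k \<le> x" "f (x - k) \<noteq> 0"
      using gx by (auto simp: insert_block_def split: if_splits)
    then show ?thesis
    proof cases
      case 1
      with headed_support[OF f \<open>i \<le> d\<close>, of x] show ?thesis by auto
    next
      case 3
      then have "x - k < s" using f by (simp add: conf_def)
      with 3 show ?thesis by auto
    qed (use kv in auto)
  qed
  have gi: "?g i = f i" by (simp add: insert_block_def)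
  have gk: "?g x = f (x - k)" if "?p + k \<le> x" for x
    using that kv by (auto simp: insert_block_def)
  have sp: "f x \<noteq> 0 \<Longrightarrow> f y \<noteq> 0 \<Longrightarrow> x < y \<Longrightarrow> x + d < y"
    and wrap: "f x \<noteq> 0 \<Longrightarrow> 2 \<le> f y \<Longrightarrow> x + d < s + y" for x y
    using f by (auto simp: conf_def spaced_def)
  have "?g x \<le> n + 1" for x
    using f kv by (auto simp: conf_def insert_block_def)
  moreover have "?g (s + k - 1) \<le> n"
  proof (cases "?p + k \<le> s + k - 1")
    case True
    with gk have "?g (s + k - 1) = f (s - 1)" by simp
    with f show ?thesis by (simp add: conf_def)
  next
    case False
    \<comment> \<open>Here the last position falls inside the block: for \<open>k = 1\<close> on its
      only entry, which is 0, and for \<open>k = d + 1\<close> strictly behind \<open>v\<close>,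
      because \<open>d \<ge> 1\<close>.\<close>
    with assms have "?g (s + k - 1) = 0" by (auto simp: insert_block_def)
    then show ?thesis by simp
  qed
  moreover have "0 < x \<and> x < s + k" if "?g x \<noteq> 0" for x
    using supp[OF that] assms by auto
  moreover have "x + d < y" if "?g x \<noteq> 0" "?g y \<noteq> 0" "x < y" for x y
  proof -
    have "x + d < y" if "?p + k \<le> x" "f (x - k) \<noteq> 0" "f (y - k) \<noteq> 0"
    proof -
      have "x - k < y - k" using that \<open>x < y\<close> by linarith
      from sp[OF that(2,3) this] that(1) show ?thesis by linarith
    qed
    with supp[OF that(1)] supp[OF that(2)] \<open>x < y\<close> assms(3,5) show ?thesis by auto
  qed
  moreover have "x + d < s + k + y" if "?g x \<noteq> 0" "2 \<le> ?g y" for x y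
  proof -
    have "?g y \<noteq> 0" using that by simp
    \<comment> \<open>For \<open>d < y\<close> the wraparound bound is automatic, as
      \<open>x\<close> is below the modulus; only the head can be critical.\<close>
    from supp[OF this] consider "y = i" | "d < y" by auto
    then show ?thesis
    proof cases
      case 1
      show ?thesis
        using supp[OF that(1)] wrap[of "x - k" i] that(2) gi 1 assms by auto
    next
      case 2
      with supp[OF that(1)] assms show ?thesis by auto
    qed
  qed
  moreover have "x = i" if "x \<le> d" "?g x \<noteq> 0" for x
    using supp[OF that(2)] that(1) by auto
  moreover have "0 < i \<longrightarrow> ?g i \<noteq> 0"
    using f gi by (simp add: headed_def)
  ultimately show ?thesis by (auto simp: conf_def headed_def spaced_def)
qed

text \<open>Entries from behind the block land at \<open>d + i + 1\<close> or later, so they stay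
  more than \<open>d\<close> away from the head. Their positions and the modulus drop by the same
  \<open>k\<close>, which preserves the wraparound condition.\<close>

lemma delete_block_conf:
  assumes g: "g \<in> conf d n (s + k)" "g \<in> headed d i" and "1 \<le> d" "i \<le> d" "2 * d + 1 \<le> s" "0 < k"
  shows "delete_block (d + i + 1) k g \<in> conf d n s \<inter> headed d i"
proof -
  let ?p = "d + i + 1"
  let ?f = "delete_block ?p k g"
  have supp: "x = i \<and> 0 < i \<and> g i \<noteq> 0 \<or> ?p \<le> x \<and> x < s \<and> g (x + k) \<noteq> 0" if "?f x \<noteq> 0" for x
  proof (cases "x < ?p")
    case True
    with that headed_support[OF g \<open>i \<le> d\<close>, of x] show ?thesis by (auto simp: delete_block_def)
  next
    case False
    with that have "g (x + k) \<noteq> 0" by (simp add: delete_block_def)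
    moreover from this have "x + k < s + k" using g unfolding conf_def by blast
    ultimately show ?thesis using False by simp
  qed
  have fi: "?f i = g i" by (simp add: delete_block_def)
  have sp: "g x \<noteq> 0 \<Longrightarrow> g y \<noteq> 0 \<Longrightarrow> x < y \<Longrightarrow> x + d < y"
    and wrap: "g x \<noteq> 0 \<Longrightarrow> 2 \<le> g y \<Longrightarrow> x + d < s + k + y" for x y
    using g by (auto simp: conf_def spaced_def)
  have "?f x \<le> n + 1" for x
    using g by (simp add: conf_def delete_block_def)
  moreover have "?f (s - 1) \<le> n"
  proof (cases "s - 1 < ?p")
    case True
    moreover have "s - 1 \<noteq> i" using assms by linarith
    ultimately have "?f (s - 1) = 0" using supp[of "s - 1"] by (meson not_less)
    then show ?thesis by simp
  next
    case False
    then have "?f (s - 1) = g (s + k - 1)" using assms by (simp add: delete_block_def)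
    with g show ?thesis by (simp add: conf_def)
  qed
  moreover have "0 < x \<and> x < s" if "?f x \<noteq> 0" for x
    using supp[OF that] assms by auto
  moreover have "x + d < y" if "?f x \<noteq> 0" "?f y \<noteq> 0" "x < y" for x y
    using supp[OF that(1)] supp[OF that(2)] that(3) sp[of "x + k" "y + k"] assms by auto
  moreover have "x + d < s + y" if "?f x \<noteq> 0" "2 \<le> ?f y" for x y
  proof -
    have "?f y \<noteq> 0" using that by simp
    from supp[OF this] consider "y = i" | "d < y" by auto
    then show ?thesis
    proof cases
      case 1
      show ?thesis
        using supp[OF that(1)] wrap[of "x + k" i] that(2) fi 1 assms by auto
    next
      case 2
      with supp[OF that(1)] assms show ?thesis by auto
    qed
  qed
  moreover have "x = i" if "x \<le> d" "?f x \<noteq> 0" for x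
    using supp[OF that(2)] that(1) by auto
  moreover have "0 < i \<longrightarrow> ?f i \<noteq> 0"
    using g fi by (simp add: headed_def)
  ultimately show ?thesis by (auto simp: conf_def headed_def spaced_def)
qed

text \<open>For fixed \<open>i\<close> the position \<open>?p\<close> is the same for all functions,
  and the split is by whether it is occupied. The bound on \<open>s\<close> gives
  \<open>s - d - 1 \<ge> 2 * d + 1\<close>, as needed for inserting and deleting blocks.\<close>

lemma card_headed_conf_recurrence:
  assumes "1 \<le> d" "i \<le> d" "3 * d + 2 \<le> s"
  shows "card (conf d n s \<inter> headed d i) =
    card (conf d n (s - 1) \<inter> headed d i) + (n + 1) * card (conf d n (s - d - 1) \<inter> headed d i)"
proof -
  let ?p = "d + i + 1"
  let ?C = "\<lambda>s. conf d n s \<inter> headed d i"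
  let ?Z = "{g \<in> ?C s. g ?p = 0}" and ?B = "{g \<in> ?C s. g ?p \<noteq> 0}"
  have "bij_betw (insert_block ?p 1 0) (?C (s - 1)) ?Z"
  proof (rule bij_betw_byWitness[where f' = "delete_block ?p 1"])
    show "\<forall>f\<in>?C (s - 1). delete_block ?p 1 (insert_block ?p 1 0 f) = f"
      by (simp add: delete_insert_block)
    show "\<forall>g\<in>?Z. insert_block ?p 1 0 (delete_block ?p 1 g) = g"
    proof
      fix g assume "g \<in> ?Z"
      then have "g ?p = 0" by simp
      moreover have "insert_block ?p 1 (g ?p) (delete_block ?p 1 g) = g"
        by (rule insert_delete_block) auto
      ultimately show "insert_block ?p 1 0 (delete_block ?p 1 g) = g" by simp
    qed
    show "insert_block ?p 1 0 ` ?C (s - 1) \<subseteq> ?Z"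
    proof (rule image_subsetI)
      fix f assume "f \<in> ?C (s - 1)"
      then have "insert_block ?p 1 0 f \<in> conf d n (s - 1 + 1) \<inter> headed d i"
        using assms by (intro insert_block_conf) auto
      then show "insert_block ?p 1 0 f \<in> ?Z"
        using assms by simp
    qed
    show "delete_block ?p 1 ` ?Z \<subseteq> ?C (s - 1)"
    proof (rule image_subsetI)
      fix g assume "g \<in> ?Z"
      then show "delete_block ?p 1 g \<in> ?C (s - 1)"
        using assms by (intro delete_block_conf) auto
    qed
  qed
  then have Z: "card ?Z = card (?C (s - 1))" by (simp add: bij_betw_same_card)
  let ?ins = "\<lambda>(v, f). insert_block ?p (d + 1) v f"
    and ?del = "\<lambda>g. (g ?p, delete_block ?p (d + 1) g)"
  have zero: "g x = 0" if "g \<in> ?B" "?p < x" "x < ?p + (d + 1)" for g x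
  proof (rule ccontr)
    assume "g x \<noteq> 0"
    with that(1,2) have "?p + d < x" by (auto simp only: conf_def spaced_def mem_Collect_eq Int_iff)
    with that(3) show False by simp
  qed
  \<comment> \<open>All \<open>n + 1\<close> nonzero values can occur at \<open>?p\<close>: since
    \<open>?p \<le> 2 * d + 1 < s - 1\<close>, the stricter bound at the last position does not
    affect it.\<close>
  have "bij_betw ?ins ({1..n + 1} \<times> ?C (s - d - 1)) ?B"
  proof (rule bij_betw_byWitness[where f' = ?del])
    show "\<forall>a\<in>{1..n + 1} \<times> ?C (s - d - 1). ?del (?ins a) = a"
      by (auto simp: delete_insert_block)
    show "\<forall>g\<in>?B. ?ins (?del g) = g"
    proof
      fix g assume "g \<in> ?B"
      from insert_delete_block[of ?p "d + 1" g, OF zero[OF this]] show "?ins (?del g) = g" by simp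
    qed
    show "?ins ` ({1..n + 1} \<times> ?C (s - d - 1)) \<subseteq> ?B"
    proof (rule image_subsetI)
      fix a assume "a \<in> {1..n + 1} \<times> ?C (s - d - 1)"
      then obtain v f where a: "a = (v, f)" "1 \<le> v" "v \<le> n + 1" "f \<in> ?C (s - d - 1)" by auto
      then have "insert_block ?p (d + 1) v f \<in> conf d n (s - d - 1 + (d + 1)) \<inter> headed d i"
        using assms by (intro insert_block_conf) auto
      moreover have "s - d - 1 + (d + 1) = s" using assms by simp
      ultimately show "?ins a \<in> ?B" using a by simp
    qed
    show "?del ` ?B \<subseteq> {1..n + 1} \<times> ?C (s - d - 1)"
    proof (rule image_subsetI)
      fix g assume g: "g \<in> ?B"
      have eq: "s - d - 1 + (d + 1) = s" using assms by simp
      have "delete_block ?p (d + 1) g \<in> ?C (s - d - 1)"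
        using assms g by (intro delete_block_conf) (auto simp: eq)
      moreover have "g ?p \<in> {1..n + 1}" using g by (auto simp: conf_def Suc_le_eq)
      ultimately show "?del g \<in> {1..n + 1} \<times> ?C (s - d - 1)" by simp
    qed
  qed
  then have "card ?B = card ({1..n + 1} \<times> ?C (s - d - 1))"
    by (rule bij_betw_same_card[symmetric])
  then have B: "card ?B = (n + 1) * card (?C (s - d - 1))"
    by (simp only: card_cartesian_product card_atLeastAtMost) simp
  have "?C s = ?Z \<union> ?B" by auto
  moreover have "card (?Z \<union> ?B) = card ?Z + card ?B"
    by (rule card_Un_disjoint) (auto intro: finite_subset[OF _ finite_conf[of d n s]])
  ultimately show ?thesis by (simp only: Z B)
qed

text \<open>Two occupied positions up to \<open>d\<close> would be too close, so the head is unique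
  and the classes \<open>headed d i\<close> partition the configurations; \<open>i = 0\<close>
  collects those without a head.\<close>

lemma card_conf_eq_sum:
  "card (conf d n s) = (\<Sum>i\<le>d. card (conf d n s \<inter> headed d i))"
proof -
  have "conf d n s = (\<Union>i\<in>{..d}. conf d n s \<inter> headed d i)"
  proof (rule set_eqI)
    fix f
    have "\<exists>i\<le>d. f \<in> headed d i" if f: "f \<in> conf d n s"
    proof (cases "\<exists>i\<le>d. f i \<noteq> 0")
      case True
      then obtain i where i: "i \<le> d" "f i \<noteq> 0" by blast
      have "x = i" if "x \<le> d" "f x \<noteq> 0" for x
      proof (rule ccontr)
        assume "x \<noteq> i"
        then have "x < i \<or> i < x" by linarith
        moreover have "x < i \<longrightarrow> x + d < i" "i < x \<longrightarrow> i + d < x"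
          using f i that by (simp_all add: conf_def spaced_def)
        ultimately show False using i that by auto
      qed
      with i show ?thesis by (auto simp: headed_def)
    next
      case False
      then have "f \<in> headed d 0" by (simp add: headed_def)
      then show ?thesis by blast
    qed
    then show "f \<in> conf d n s \<longleftrightarrow> f \<in> (\<Union>i\<in>{..d}. conf d n s \<inter> headed d i)" by auto
  qed
  also have "card \<dots> = (\<Sum>i\<in>{..d}. card (conf d n s \<inter> headed d i))"
  proof (rule card_UN_disjoint)
    show "\<forall>i\<in>{..d}. \<forall>j\<in>{..d}. i \<noteq> j \<longrightarrow>
        (conf d n s \<inter> headed d i) \<inter> (conf d n s \<inter> headed d j) = {}"
      by (auto simp: headed_def)
  qed (simp_all add: finite_conf)
  finally show ?thesis .
qed

theorem theorem6p3:
  fixes d n s :: nat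
  assumes "d \<ge> 1" and "n \<ge> 1" and "s \<ge> 3 * d + 2"
  shows "N d (n * s - 1) s =
    N d (n * (s - 1) - 1) (s - 1) + (n + 1) * N d (n * (s - d - 1) - 1) (s - d - 1)"
proof -
  have "card (conf d n s) = (\<Sum>i\<le>d. card (conf d n (s - 1) \<inter> headed d i) +
      (n + 1) * card (conf d n (s - d - 1) \<inter> headed d i))"
    unfolding card_conf_eq_sum[of d n s]
    using assms by (intro sum.cong refl card_headed_conf_recurrence) auto
  also have "\<dots> = card (conf d n (s - 1)) + (n + 1) * card (conf d n (s - d - 1))"
    by (simp only: sum.distrib sum_distrib_left card_conf_eq_sum[of d n "s - 1"]
        card_conf_eq_sum[of d n "s - d - 1"])
  finally have "card (conf d n s) = \<dots>" .
  \<comment> \<open>Each of the three moduli must exceed \<open>d\<close> for its count of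
    configurations to equal the corresponding value of \<open>N\<close>.\<close>
  moreover have "d < s" "d < s - 1" "d < s - d - 1" using assms by auto
  ultimately show ?thesis using assms by (simp only: N_eq_card_conf)
qed

end
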